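(* For each $d\in\overline D$ and each $C\in\mathcal C_1$, the inequality $\sum_{ij\in C}x_{ij}\leq |C|-\sum_{ij\in C}d_{ij}$ defines a facet of $P_{\mathrm{MTZ}}(d)$ if and only if $\sum_{ij\in C}d_{ij}>0$ and $|C|\leq n-2$.
   Context: Let $n\ge 4$, $N=\{1,\dots,n\}$, $A=\{ij : i,j\in N,\ i\ne j\}$, $N_1=N\setminus\{1\}$, $A_1=\{ij : i,j\in N_1,\ i\neq j\}$. $\mathcal C_1$ is the set of (simple) directed cycles with arcs in $A_1$, each of length at least 2 and identified with its set of arcs; $|C|$ is the number of arcs. $P_{\mathrm{AP}}$ is the set of $x\in[0,1]^A$ with $\sum_{j\neq i}x_{ij}=1$ and $\sum_{j\ne i}x_{ji}=1$ for all $i\in N$. $\overline D=\{d\in\mathbb R_+^{A_1} : \sum_{ij\in C}d_{ij}\le 1\ \text{for all } C\in\mathcal C_1\}$, where $\mathbb R_+$ denotes the nonnegative reals. For $d\in\overline D$, $P_{\mathrm{MTZ}}(d)$ is the projection onto the $x$ variables of $$Q_{\mathrm{MTZ}}(d)=\{(x,u)\in P_{\mathrm{AP}}\times\mathbb R^{N_1} : u_i-u_j+d_{ij}\le 1-x_{ij}\ \text{for all } ij\in A_1\}.$$ *)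

theory Defs
  imports
    "HOL-Analysis.Analysis"
    "Graph_Theory.Graph_Theory"
begin

text \<open>
  The node set is the universe of a finite type \<open>'n\<close>, so \<open>n = CARD('n)\<close>, and the
  distinguished node is an arbitrary \<open>r :: 'n\<close>.
  The space of real vectors indexed by a subset \<open>I\<close> of \<open>'i\<close> is represented as the
  coordinate subspace of \<open>real ^ 'i\<close> of the vectors vanishing outside \<open>I\<close>.
\<close>

definition coord_space :: "'i set \<Rightarrow> (real ^ 'i::finite) set" where
  "coord_space I = {x. \<forall>i. i \<notin> I \<longrightarrow> x $ i = 0}"

definition all_arcs :: "('n \<times> 'n) set" where
  "all_arcs = {(i, j). i \<noteq> j}"

definition nonroot_nodes :: "'n \<Rightarrow> 'n set" where
  "nonroot_nodes r = UNIV - {r}"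

definition nonroot_arcs :: "'n \<Rightarrow> ('n \<times> 'n) set" where
  "nonroot_arcs r = {(i, j). i \<in> nonroot_nodes r \<and> j \<in> nonroot_nodes r \<and> i \<noteq> j}"

definition nonroot_digraph :: "'n \<Rightarrow> ('n, 'n \<times> 'n) pre_digraph" where
  "nonroot_digraph r =
    \<lparr>verts = nonroot_nodes r, arcs = nonroot_arcs r, tail = fst, head = snd\<rparr>"

text \<open>
  A library cycle is a closed arc list without repeated nodes; only its set of arcs is kept.
  There are no loops, so the length condition only makes the convention explicit.
\<close>

definition nonroot_cycles :: "'n \<Rightarrow> ('n \<times> 'n) set set" where
  "nonroot_cycles r = {set p | p. pre_digraph.cycle (nonroot_digraph r) p \<and> 2 \<le> length p}"

definition P_AP :: "(real ^ ('n::finite \<times> 'n)) set" where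
  "P_AP = {x \<in> coord_space all_arcs.
     (\<forall>a\<in>all_arcs. 0 \<le> x $ a \<and> x $ a \<le> 1) \<and>
     (\<forall>i. (\<Sum>j\<in>UNIV - {i}. x $ (i, j)) = 1) \<and>
     (\<forall>i. (\<Sum>j\<in>UNIV - {i}. x $ (j, i)) = 1)}"

definition D_bar :: "'n::finite \<Rightarrow> (real ^ ('n \<times> 'n)) set" where
  "D_bar r = {d \<in> coord_space (nonroot_arcs r).
     (\<forall>a\<in>nonroot_arcs r. 0 \<le> d $ a) \<and>
     (\<forall>C\<in>nonroot_cycles r. (\<Sum>a\<in>C. d $ a) \<le> 1)}"

definition Q_MTZ ::
    "'n::finite \<Rightarrow> real ^ ('n \<times> 'n) \<Rightarrow> ((real ^ ('n \<times> 'n)) \<times> (real ^ 'n)) set" where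
  "Q_MTZ r d = {(x, u). x \<in> P_AP \<and> u \<in> coord_space (nonroot_nodes r) \<and>
     (\<forall>(i, j)\<in>nonroot_arcs r. u $ i - u $ j + d $ (i, j) \<le> 1 - x $ (i, j))}"

definition P_MTZ :: "'n::finite \<Rightarrow> real ^ ('n \<times> 'n) \<Rightarrow> (real ^ ('n \<times> 'n)) set" where
  "P_MTZ r d = fst ` Q_MTZ r d"

text \<open>
  The inequality \<open>f x \<le> b\<close> (for a linear functional \<open>f\<close>) is valid for \<open>P\<close>
  and the face it induces is a facet of \<open>P\<close>.
\<close>

definition defines_facet :: "('a::euclidean_space \<Rightarrow> real) \<Rightarrow> real \<Rightarrow> 'a set \<Rightarrow> bool" where
  "defines_facet f b P \<longleftrightarrow> (\<forall>x\<in>P. f x \<le> b) \<and> {x \<in> P. f x = b} facet_of P"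

end

theory Submission
  imports Defs "HOL-Combinatorics.Cycles"
begin

text \<open>
  Summing the constraints around a cycle eliminates the potentials, and conversely shortest paths
  provide potentials as soon as no cycle inequality fails. So \<open>P_MTZ r d\<close> consists of the points of
  the assignment polytope that satisfy all inequalities of the theorem, one for each nonroot cycle
  (\<open>P_MTZ_eq\<close>). Two kinds of points then decide everything. The uniform assignment satisfies
  each constraint strictly (\<open>uniform_vec_cycle_less\<close>), and an integral assignment satisfies the
  inequality of every cycle it does not contain, because \<open>d\<close> has weight at most 1 on each cycle.

  Suppose that \<open>d\<close> is positive on \<open>C\<close> in total and that \<open>C\<close> omits at least two nodes. Together with
  a cycle through all the omitted nodes, \<open>C\<close> forms an assignment that violates the inequality of
  \<open>C\<close> and no other one. An inequality that can be violated alone is irredundant and defines a facet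
  (\<open>facet_of_violated_inequality\<close>, \<open>cycle_facet\<close>).

  In the remaining cases the face lies in a proper face \<open>x $ a = 0\<close>: if \<open>d\<close> has total weight 0 on \<open>C\<close>,
  then \<open>x\<close> must be 1 on \<open>C\<close> and 0 on the other arcs leaving its nodes; if \<open>C\<close> visits all nodes
  except \<open>r\<close>, then \<open>C\<close> must carry the whole weight of the nonroot arcs. A facet cannot be contained
  in a different proper face (\<open>facet_maximal\<close>), and a Hamiltonian tour separates the two faces
  (\<open>no_facet_if_sum_zero\<close>, \<open>no_facet_if_spanning\<close>).
\<close>

section \<open>Cycles as cyclic permutations of node lists\<close>

text \<open>
  Writing a cycle as the graph of a permutation of its node set turns telescoping sums into
  reindexing and the comparison of a cycle with an assignment into an agreement of two functions.
\<close>

definition cycle_arcs :: "'a list \<Rightarrow> ('a \<times> 'a) set" where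
  "cycle_arcs xs = (\<lambda>i. (i, cycle_of_list xs i)) ` set xs"

lemma cycle_of_list_nth:
  assumes "distinct xs" "k < length xs"
  shows "cycle_of_list xs (xs ! k) = xs ! (Suc k mod length xs)"
proof -
  have "map (cycle_of_list xs) xs ! k = rotate1 xs ! k"
    using cyclic_rotation[OF assms(1), of 1] by simp
  then show ?thesis
    using assms(2) by (simp add: nth_rotate1)
qed

lemma cycle_of_list_no_fixpoint:
  assumes "distinct xs" "2 \<le> length xs" "i \<in> set xs"
  shows "cycle_of_list xs i \<noteq> i"
proof -
  obtain k where k: "k < length xs" "i = xs ! k"
    using assms(3) by (metis in_set_conv_nth)
  have "Suc k mod length xs \<noteq> k" "Suc k mod length xs < length xs"
    using k(1) assms(2) by (auto simp: mod_Suc)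
  then show ?thesis
    using k assms(1) by (simp add: cycle_of_list_nth nth_eq_iff_index_eq)
qed

lemma cycle_of_list_in_set: "i \<in> set xs \<Longrightarrow> cycle_of_list xs i \<in> set xs"
  using permutes_in_image[OF cycle_permutes] by metis

text \<open>
  A cycle that meets a set closed under its successor map never leaves it, and so lies in it. This
  irreducibility shows that a Hamiltonian tour contains no other cycle.
\<close>

lemma set_subset_of_cycle_closed:
  assumes "distinct xs" "i \<in> set xs" "i \<in> S"
    and closed: "\<And>j. j \<in> set xs \<Longrightarrow> j \<in> S \<Longrightarrow> cycle_of_list xs j \<in> S"
  shows "set xs \<subseteq> S"
proof
  fix j assume "j \<in> set xs"
  obtain k where k: "k < length xs" "i = xs ! k"
    using assms(2) by (metis in_set_conv_nth)
  have step: "xs ! ((k + m) mod length xs) \<in> S" for m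
  proof (induction m)
    case 0
    then show ?case using k assms(3) by simp
  next
    case (Suc m)
    have lt: "(k + m) mod length xs < length xs"
      using k(1) by (intro mod_less_divisor) auto
    have "cycle_of_list xs (xs ! ((k + m) mod length xs)) \<in> S"
      using Suc lt by (intro closed) auto
    then show ?case
      using lt assms(1) by (simp add: cycle_of_list_nth mod_Suc_eq)
  qed
  obtain l where l: "l < length xs" "j = xs ! l"
    using \<open>j \<in> set xs\<close> by (metis in_set_conv_nth)
  have "(k + (l + length xs - k)) mod length xs = l"
    using k(1) l(1) by simp
  then show "j \<in> S"
    using step[of "l + length xs - k"] l(2) by simp
qed

lemma cycle_arcs_zip:
  assumes "distinct xs"
  shows "cycle_arcs xs = set (zip xs (rotate1 xs))"
proof -
  have "rotate1 xs = map (cycle_of_list xs) xs"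
    using cyclic_rotation[OF assms, of 1] by simp
  then show ?thesis
    by (simp add: cycle_arcs_def zip_map2 zip_same_conv_map)
qed

lemma finite_cycle_arcs [simp]: "finite (cycle_arcs xs)"
  by (simp add: cycle_arcs_def)

lemma sum_cycle_arcs: "sum g (cycle_arcs xs) = (\<Sum>i\<in>set xs. g (i, cycle_of_list xs i))"
  unfolding cycle_arcs_def by (subst sum.reindex) (auto intro: inj_onI)

lemma card_cycle_arcs: "distinct xs \<Longrightarrow> card (cycle_arcs xs) = length xs"
  unfolding cycle_arcs_def by (subst card_image) (auto intro: inj_onI simp: distinct_card)

lemma cycle_arcs_subset_all_arcs:
  "distinct xs \<Longrightarrow> 2 \<le> length xs \<Longrightarrow> cycle_arcs xs \<subseteq> all_arcs"
  using cycle_of_list_no_fixpoint[of xs] by (fastforce simp: cycle_arcs_def all_arcs_def)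

lemma cycle_arcs_subset_nonroot_arcs:
  assumes "distinct xs" "2 \<le> length xs" "r \<notin> set xs"
  shows "cycle_arcs xs \<subseteq> nonroot_arcs r"
proof -
  have "fst ` cycle_arcs xs \<subseteq> set xs" "snd ` cycle_arcs xs \<subseteq> set xs"
    by (auto simp: cycle_arcs_def cycle_of_list_in_set)
  then show ?thesis
    using assms(3) cycle_arcs_subset_all_arcs[OF assms(1,2)]
    by (force simp: nonroot_arcs_def nonroot_nodes_def all_arcs_def)
qed

lemma cas_zip:
  assumes "tail G = fst" "head G = snd"
  shows "pre_digraph.cas G u (zip (u # vs) (vs @ [w])) w"
  using assms by (induction vs arbitrary: u) (simp_all add: pre_digraph.cas.simps)

lemma cas_head_last:
  assumes "pre_digraph.cas G u p v" "p \<noteq> []"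
  shows "head G (last p) = v"
  using assms by (induction p arbitrary: u) (auto simp: pre_digraph.cas.simps split: if_splits)

text \<open>
  Along a closed walk, the list of heads is the rotation by one of the list of tails, so an arc list
  that forms a cycle is the pairing of a list of distinct nodes with its rotation.
\<close>

lemma nonroot_cycles_eq:
  "nonroot_cycles r = {cycle_arcs xs | xs. distinct xs \<and> 2 \<le> length xs \<and> r \<notin> set xs}"
proof (intro equalityI subsetI)
  let ?G = "nonroot_digraph r"
  have ht: "tail ?G = fst" "head ?G = snd"
    by (simp_all add: nonroot_digraph_def)
  {
    fix C assume "C \<in> nonroot_cycles r"
    then obtain p u where C: "C = set p" and len: "2 \<le> length p"
      and walk: "pre_digraph.awalk ?G u p u"
      and dist: "distinct (tl (pre_digraph.awalk_verts ?G u p))"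
      by (auto simp: nonroot_cycles_def pre_digraph.cycle_def)
    have ne: "p \<noteq> []" using len by auto
    have cas: "pre_digraph.cas ?G u p u" and arcs: "set p \<subseteq> nonroot_arcs r"
      using walk by (auto simp: pre_digraph.awalk_def nonroot_digraph_def)
    have v1: "pre_digraph.awalk_verts ?G u p = map fst p @ [snd (last p)]"
      using ne by (simp add: pre_digraph.awalk_verts_conv ht)
    have v2: "pre_digraph.awalk_verts ?G u p = fst (hd p) # map snd p"
      using pre_digraph.awalk_verts_conv'[OF cas] ne by (simp add: ht)
    have "fst (hd p) = u"
      using cas ne by (cases p) (auto simp: pre_digraph.cas.simps ht)
    moreover have "snd (last p) = u"
      using cas_head_last[OF cas ne] by (simp add: ht)
    ultimately have rot: "map snd p = rotate1 (map fst p)"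
      using v1 v2 ne by (cases p) auto
    have "distinct (map fst p)"
      using dist v2 rot by (metis distinct1_rotate list.sel(3))
    moreover have "p = zip (map fst p) (rotate1 (map fst p))"
      by (simp add: rot[symmetric] zip_map_fst_snd)
    moreover have "r \<notin> set (map fst p)"
      using arcs by (auto simp: nonroot_arcs_def nonroot_nodes_def)
    ultimately show "C \<in> {cycle_arcs xs | xs. distinct xs \<and> 2 \<le> length xs \<and> r \<notin> set xs}"
      using C len cycle_arcs_zip[of "map fst p"] by (auto intro!: exI[of _ "map fst p"])
  }
  {
    fix C assume "C \<in> {cycle_arcs xs | xs. distinct xs \<and> 2 \<le> length xs \<and> r \<notin> set xs}"
    then obtain xs where C: "C = cycle_arcs xs" and xs: "distinct xs" "2 \<le> length xs" "r \<notin> set xs"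
      by blast
    obtain v vs where v: "xs = v # vs" using xs(2) by (cases xs) auto
    let ?p = "zip xs (rotate1 xs)"
    have cas: "pre_digraph.cas ?G v ?p v"
      using cas_zip[OF ht] by (simp add: v)
    have ne: "?p \<noteq> []" by (simp add: v)
    have "pre_digraph.awalk ?G v ?p v"
      using cas xs(3) cycle_arcs_subset_nonroot_arcs[OF xs]
      unfolding pre_digraph.awalk_def cycle_arcs_zip[OF xs(1)]
      by (auto simp: nonroot_digraph_def nonroot_nodes_def v)
    moreover have "tl (pre_digraph.awalk_verts ?G v ?p) = rotate1 xs"
      using pre_digraph.awalk_verts_conv'[OF cas] ne by (simp add: ht)
    ultimately have "pre_digraph.cycle ?G ?p"
      unfolding pre_digraph.cycle_def using ne xs(1) by (metis distinct1_rotate)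
    then show "C \<in> nonroot_cycles r"
      using C xs(2) cycle_arcs_zip[OF xs(1)] by (auto simp: nonroot_cycles_def)
  }
qed

section \<open>Potentials for weights without negative cycles\<close>

fun path_weight :: "('a \<times> 'a \<Rightarrow> real) \<Rightarrow> 'a list \<Rightarrow> real" where
  "path_weight w (i # j # xs) = w (i, j) + path_weight w (j # xs)"
| "path_weight w xs = 0"

lemma path_weight_split:
  "path_weight w (xs @ j # ys) = path_weight w (xs @ [j]) + path_weight w (j # ys)"
  by (induction w xs rule: path_weight.induct) (auto simp: neq_Nil_conv)

lemma path_weight_zip:
  "path_weight w (j # ys @ [k]) = sum_list (map w (zip (j # ys) (ys @ [k])))"
  by (induction ys arbitrary: j) auto

lemma path_weight_closed:
  assumes "distinct (j # ys)"
  shows "path_weight w (j # ys @ [j]) = sum w (cycle_arcs (j # ys))"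
  using assms unfolding path_weight_zip cycle_arcs_zip[OF assms]
  by (subst sum_list_distinct_conv_sum_set[symmetric]) (auto intro: distinct_zipI1)

text \<open>
  The classical shortest path potential: \<open>- u j\<close> is the least weight of a path that ends in \<open>j\<close>,
  from any start. Only finitely many paths compete because they have distinct nodes. If
  appending \<open>j\<close> to an optimal path to \<open>i\<close> revisits \<open>j\<close>, the loop so created is a cycle, and
  cutting it off does not increase the weight.
\<close>

lemma potential_of_nonneg_cycles:
  fixes w :: "'a::finite \<times> 'a \<Rightarrow> real"
  assumes nonneg: "\<And>xs. distinct xs \<Longrightarrow> 2 \<le> length xs \<Longrightarrow> set xs \<subseteq> V \<Longrightarrow> 0 \<le> sum w (cycle_arcs xs)"
  obtains u where "\<And>i j. i \<in> V \<Longrightarrow> j \<in> V \<Longrightarrow> i \<noteq> j \<Longrightarrow> u i - u j \<le> w (i, j)"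
proof -
  define paths where "paths j = {p. distinct p \<and> set p \<subseteq> V \<and> p \<noteq> [] \<and> last p = j}" for j
  define m where "m j = Min (path_weight w ` paths j)" for j
  have fin: "finite (paths j)" for j
    by (rule finite_subset[OF _ finite_subset_distinct[OF finite, of V]]) (auto simp: paths_def)
  have le: "m j \<le> path_weight w p" if "p \<in> paths j" for j p
    unfolding m_def using fin that by auto
  have "m j \<le> m i + w (i, j)" if ij: "i \<in> V" "j \<in> V" "i \<noteq> j" for i j
  proof -
    have "[i] \<in> paths i" using ij by (auto simp: paths_def)
    then have "m i \<in> path_weight w ` paths i"
      unfolding m_def using fin by (intro Min_in) auto
    then obtain p where p: "p \<in> paths i" "m i = path_weight w p" by auto
    define q where "q = butlast p"
    have pq: "p = q @ [i]"
      using p(1) by (auto simp: paths_def q_def)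
    have w: "path_weight w (p @ [j]) = m i + w (i, j)"
      using path_weight_split[of w q i "[j]"] p(2) by (simp add: pq)
    show ?thesis
    proof (cases "j \<in> set p")
      case False
      then have "p @ [j] \<in> paths j" using p(1) ij by (auto simp: paths_def)
      then show ?thesis using le w by metis
    next
      case True
      then obtain xs ys where xy: "p = xs @ j # ys" by (meson split_list)
      have ys: "ys \<noteq> []" using xy p(1) ij by (auto simp: paths_def)
      have D: "distinct (j # ys)" "set (j # ys) \<subseteq> V"
        using p(1) by (auto simp: paths_def xy)
      have "0 \<le> sum w (cycle_arcs (j # ys))"
        using ys by (intro nonneg D) (cases ys, auto)
      then have "path_weight w (xs @ [j]) \<le> path_weight w (p @ [j])"
        using path_weight_split[of w xs j "ys @ [j]"] path_weight_closed[OF D(1), of w]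
        by (simp add: xy)
      moreover have "xs @ [j] \<in> paths j" using p(1) by (auto simp: paths_def xy)
      ultimately show ?thesis using le w by (metis order_trans)
    qed
  qed
  then show ?thesis
    by (intro that[of "\<lambda>i. - m i"]) (simp add: algebra_simps)
qed

section \<open>Facets of polyhedra\<close>

text \<open>
  An irredundancy criterion. The segment from the strictly feasible point \<open>x\<^sub>0\<close> to a point \<open>y\<close>
  that violates only the inequality \<open>a \<bullet> x \<le> c\<close> crosses the hyperplane \<open>a \<bullet> x = c\<close> at a point
  \<open>z\<close> where every other inequality is strict. Hence, near \<open>z\<close>, the face is all of
  \<open>L \<inter> {x. a \<bullet> x = c}\<close>, which is one dimension below \<open>L\<close>, while \<open>P\<close> has the dimension of
  \<open>L\<close> because of \<open>x\<^sub>0\<close>.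
\<close>

lemma facet_of_violated_inequality:
  fixes L :: "'v::euclidean_space set" and K :: "('v \<times> real) set"
  assumes "finite K" "affine L" and P: "P = {x \<in> L. \<forall>(g, b)\<in>K. g \<bullet> x \<le> b}"
    and "x\<^sub>0 \<in> L" and strict: "\<And>g b. (g, b) \<in> K \<Longrightarrow> g \<bullet> x\<^sub>0 < b"
    and ac: "(a, c) \<in> K" and "y \<in> L" and viol: "c < a \<bullet> y"
    and others: "\<And>g b. (g, b) \<in> K \<Longrightarrow> (g, b) \<noteq> (a, c) \<Longrightarrow> g \<bullet> y \<le> b"
  shows "(P \<inter> {x. a \<bullet> x = c}) facet_of P"
proof -
  \<comment> \<open>The open region where the selected constraints hold strictly.\<close>
  define U where "U K' = (\<Inter>(g, b)\<in>K'. {x. g \<bullet> x < b})" for K' :: "('v \<times> real) set"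
  have openU: "open (U K')" if "K' \<subseteq> K" for K'
    unfolding U_def using finite_subset[OF that \<open>finite K\<close>]
    by (intro open_INT) (auto intro: open_halfspace_lt)
  let ?H = "{x. a \<bullet> x = c}"
  \<comment> \<open>The parameter at which the segment from \<open>x\<^sub>0\<close> to \<open>y\<close> meets the hyperplane.\<close>
  define t where "t = (c - a \<bullet> x\<^sub>0) / (a \<bullet> y - a \<bullet> x\<^sub>0)"
  have t: "0 < t" "t < 1" using strict[OF ac] viol by (auto simp: t_def)
  define z where "z = (1 - t) *\<^sub>R x\<^sub>0 + t *\<^sub>R y"
  have zL: "z \<in> L"
    unfolding z_def using \<open>affine L\<close> \<open>x\<^sub>0 \<in> L\<close> \<open>y \<in> L\<close> by (intro mem_affine) auto
  have "a \<bullet> z = a \<bullet> x\<^sub>0 + t * (a \<bullet> y - a \<bullet> x\<^sub>0)"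
    by (simp add: z_def inner_add_right algebra_simps)
  then have zH: "a \<bullet> z = c"
    using strict[OF ac] viol by (simp add: t_def)
  have zU: "z \<in> U (K - {(a, c)})"
  proof -
    have "g \<bullet> z < b" if "(g, b) \<in> K" "(g, b) \<noteq> (a, c)" for g b
    proof -
      have "(1 - t) * (g \<bullet> x\<^sub>0) < (1 - t) * b" "t * (g \<bullet> y) \<le> t * b"
        using strict[OF that(1)] others[OF that] t by auto
      then show ?thesis by (simp add: z_def inner_add_right algebra_simps)
    qed
    then show ?thesis by (auto simp: U_def)
  qed
  have dimP: "aff_dim P = aff_dim L"
  proof (rule antisym)
    show "aff_dim P \<le> aff_dim L" by (rule aff_dim_subset) (auto simp: P)
    have "x\<^sub>0 \<in> L \<inter> U K" using \<open>x\<^sub>0 \<in> L\<close> strict by (auto simp: U_def)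
    then have "aff_dim (L \<inter> U K) = aff_dim L"
      using affine_hull_affine_Int_open[OF \<open>affine L\<close> openU[of K]] by (metis aff_dim_affine_hull empty_iff order_refl)
    moreover have "L \<inter> U K \<subseteq> P" unfolding P U_def by fastforce
    ultimately show "aff_dim L \<le> aff_dim P" by (metis aff_dim_subset)
  qed
  have dimF: "aff_dim (P \<inter> ?H) = aff_dim (L \<inter> ?H)"
  proof (rule antisym)
    show "aff_dim (P \<inter> ?H) \<le> aff_dim (L \<inter> ?H)" by (rule aff_dim_subset) (auto simp: P)
    have aff: "affine (L \<inter> ?H)" by (intro affine_Int \<open>affine L\<close> affine_hyperplane)
    have "z \<in> (L \<inter> ?H) \<inter> U (K - {(a, c)})" using zL zH zU by simp
    then have "aff_dim ((L \<inter> ?H) \<inter> U (K - {(a, c)})) = aff_dim (L \<inter> ?H)"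
      using affine_hull_affine_Int_open[OF aff openU[of "K - {(a, c)}"]]
      by (metis Diff_subset aff_dim_affine_hull empty_iff)
    moreover have "(L \<inter> ?H) \<inter> U (K - {(a, c)}) \<subseteq> P \<inter> ?H"
    proof
      fix x assume x: "x \<in> (L \<inter> ?H) \<inter> U (K - {(a, c)})"
      have "g \<bullet> x \<le> b" if "(g, b) \<in> K" for g b
      proof (cases "(g, b) = (a, c)")
        case True then show ?thesis using x by simp
      next
        case False
        then have "x \<in> {x. g \<bullet> x < b}" using x that unfolding U_def by blast
        then show ?thesis by simp
      qed
      then show "x \<in> P \<inter> ?H" using x by (auto simp: P)
    qed
    ultimately show "aff_dim (L \<inter> ?H) \<le> aff_dim (P \<inter> ?H)" by (metis aff_dim_subset)
  qed
  have "z \<in> P \<inter> ?H"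
  proof -
    have "g \<bullet> z \<le> b" if "(g, b) \<in> K" for g b
    proof (cases "(g, b) = (a, c)")
      case True then show ?thesis using zH by simp
    next
      case False
      then have "z \<in> {x. g \<bullet> x < b}" using zU that unfolding U_def by blast
      then show ?thesis by simp
    qed
    then show ?thesis using zL zH by (auto simp: P)
  qed
  moreover have "\<not> L \<subseteq> ?H" using \<open>y \<in> L\<close> viol by auto
  ultimately have "aff_dim (P \<inter> ?H) = aff_dim P - 1"
    using zL zH unfolding dimF dimP aff_dim_affine_Int_hyperplane[OF \<open>affine L\<close>] by auto
  moreover have "convex P"
  proof -
    have "P = L \<inter> (\<Inter>(g, b)\<in>K. {x. g \<bullet> x \<le> b})" by (auto simp: P)
    then show ?thesis
      by (auto intro!: convex_Int convex_INT affine_imp_convex[OF \<open>affine L\<close>] convex_halfspace_le)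
  qed
  then have "(P \<inter> ?H) face_of P"
    using ac by (intro face_of_Int_supporting_hyperplane_le) (auto simp: P)
  ultimately show ?thesis
    using \<open>z \<in> P \<inter> ?H\<close> by (auto simp: facet_of_def)
qed

text \<open>
  Passing to a strictly larger proper face would have to fit a dimension strictly between those
  of a facet and of the polyhedron.
\<close>

lemma facet_maximal:
  fixes P :: "'v::euclidean_space set"
  assumes "convex P" "F facet_of P" "G face_of P" "G \<noteq> P" "F \<subseteq> G"
  shows "F = G"
proof (rule ccontr)
  assume "F \<noteq> G"
  have "F face_of G"
    using assms by (meson face_of_subset face_of_imp_subset facet_of_def)
  then have "aff_dim F < aff_dim G"
    using \<open>F \<noteq> G\<close> assms(3) by (intro face_of_aff_dim_lt) (auto intro: face_of_imp_convex)
  moreover have "aff_dim G < aff_dim P"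
    using assms by (intro face_of_aff_dim_lt)
  ultimately show False using assms(2) by (simp add: facet_of_def)
qed

section \<open>The projection described by cycle inequalities\<close>

text \<open>
  The affine space that the assignment equations cut out. Its nonnegative points form the
  assignment polytope, because the equations bound each nonnegative coordinate by 1.
\<close>

definition assignment_space :: "(real ^ ('n::finite \<times> 'n)) set" where
  "assignment_space = {x \<in> coord_space all_arcs.
     (\<forall>i. (\<Sum>j\<in>UNIV - {i}. x $ (i, j)) = 1) \<and>
     (\<forall>i. (\<Sum>j\<in>UNIV - {i}. x $ (j, i)) = 1)}"

lemma affine_assignment_space: "affine assignment_space"
  by (auto simp: affine_def assignment_space_def coord_space_def sum.distrib
      sum_distrib_left[symmetric])

lemma P_AP_eq: "P_AP = {x \<in> assignment_space. \<forall>a\<in>all_arcs. 0 \<le> x $ a}"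
proof -
  have "x $ a \<le> 1"
    if x: "x \<in> assignment_space" "\<forall>a\<in>all_arcs. 0 \<le> x $ a" and a: "a \<in> all_arcs"
    for x :: "real ^ ('n::finite \<times> 'n)" and a
  proof -
    obtain i j where ij: "a = (i, j)" "i \<noteq> j" using a by (auto simp: all_arcs_def)
    have "x $ (i, j) \<le> (\<Sum>j\<in>UNIV - {i}. x $ (i, j))"
      using x(2) ij by (intro member_le_sum) (auto simp: all_arcs_def)
    then show ?thesis using x(1) ij by (simp add: assignment_space_def)
  qed
  then show ?thesis by (auto simp: P_AP_def assignment_space_def)
qed

text \<open>
  Eliminating \<open>u\<close>. Summing the constraints around a cycle cancels the potentials and leaves
  the cycle inequality. Conversely, the cycle inequalities say that the weight
  \<open>1 - x $ a - d $ a\<close> has no negative cycle, and a potential for it is a feasible \<open>u\<close>.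
\<close>

lemma P_MTZ_eq:
  "P_MTZ r d = {x \<in> P_AP. \<forall>C\<in>nonroot_cycles r.
     (\<Sum>a\<in>C. x $ a) \<le> real (card C) - (\<Sum>a\<in>C. d $ a)}"
proof (intro equalityI subsetI)
  fix x assume "x \<in> P_MTZ r d"
  then obtain u where x: "x \<in> P_AP"
    and u: "\<And>i j. (i, j) \<in> nonroot_arcs r \<Longrightarrow> u $ i - u $ j + d $ (i, j) \<le> 1 - x $ (i, j)"
    by (fastforce simp: P_MTZ_def Q_MTZ_def)
  have "(\<Sum>a\<in>C. x $ a) \<le> real (card C) - (\<Sum>a\<in>C. d $ a)" if C: "C \<in> nonroot_cycles r" for C
  proof -
    obtain xs where xs: "C = cycle_arcs xs" "distinct xs" "2 \<le> length xs" "r \<notin> set xs"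
      using C by (auto simp: nonroot_cycles_eq)
    let ?f = "cycle_of_list xs"
    have "(\<Sum>i\<in>set xs. u $ i - u $ ?f i + d $ (i, ?f i)) \<le> (\<Sum>i\<in>set xs. 1 - x $ (i, ?f i))"
    proof (rule sum_mono)
      fix i assume "i \<in> set xs"
      then have "(i, ?f i) \<in> nonroot_arcs r"
        using cycle_arcs_subset_nonroot_arcs[OF xs(2-4)] by (auto simp: cycle_arcs_def)
      then show "u $ i - u $ ?f i + d $ (i, ?f i) \<le> 1 - x $ (i, ?f i)" by (rule u)
    qed
    moreover have "(\<Sum>i\<in>set xs. u $ ?f i) = (\<Sum>i\<in>set xs. u $ i)"
      using sum.permute[OF cycle_permutes[of xs], of "\<lambda>i. u $ i"] by (simp add: o_def)
    ultimately show ?thesis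
      using xs(2) by (simp add: xs(1) sum_cycle_arcs card_cycle_arcs sum.distrib sum_subtractf distinct_card)
  qed
  then show "x \<in> {x \<in> P_AP. \<forall>C\<in>nonroot_cycles r.
     (\<Sum>a\<in>C. x $ a) \<le> real (card C) - (\<Sum>a\<in>C. d $ a)}" using x by blast
next
  fix x assume "x \<in> {x \<in> P_AP. \<forall>C\<in>nonroot_cycles r.
     (\<Sum>a\<in>C. x $ a) \<le> real (card C) - (\<Sum>a\<in>C. d $ a)}"
  then have x: "x \<in> P_AP"
    and cyc: "\<And>C. C \<in> nonroot_cycles r \<Longrightarrow> (\<Sum>a\<in>C. x $ a) \<le> real (card C) - (\<Sum>a\<in>C. d $ a)"
    by auto
  have nonneg: "0 \<le> (\<Sum>a\<in>cycle_arcs xs. 1 - x $ a - d $ a)"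
    if "distinct xs" "2 \<le> length xs" "set xs \<subseteq> nonroot_nodes r" for xs
  proof -
    have "cycle_arcs xs \<in> nonroot_cycles r"
      using that by (auto simp: nonroot_cycles_eq nonroot_nodes_def)
    then show ?thesis
      using cyc[of "cycle_arcs xs"] by (simp add: sum_subtractf)
  qed
  obtain u where u: "\<And>i j. i \<in> nonroot_nodes r \<Longrightarrow> j \<in> nonroot_nodes r \<Longrightarrow> i \<noteq> j \<Longrightarrow>
      u i - u j \<le> 1 - x $ (i, j) - d $ (i, j)"
    using potential_of_nonneg_cycles[of "nonroot_nodes r" "\<lambda>a. 1 - x $ a - d $ a", OF nonneg]
    by blast
  \<comment> \<open>Vectors over the nonroot nodes vanish at the root, so the value of \<open>u\<close> there is reset to 0.\<close>
  have "(x, \<chi> i. if i = r then 0 else u i) \<in> Q_MTZ r d"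
    using x u by (fastforce simp: Q_MTZ_def coord_space_def nonroot_nodes_def nonroot_arcs_def)
  then show "x \<in> P_MTZ r d" unfolding P_MTZ_def by force
qed

definition arc_indicator :: "('n \<times> 'n) set \<Rightarrow> real ^ ('n::finite \<times> 'n)" where
  "arc_indicator C = (\<chi> a. if a \<in> C then 1 else 0)"

lemma inner_arc_indicator: "arc_indicator C \<bullet> x = (\<Sum>a\<in>C. x $ a)"
proof -
  have "arc_indicator C \<bullet> x = (\<Sum>a\<in>UNIV. if a \<in> C then x $ a else 0)"
    unfolding inner_vec_def arc_indicator_def by (rule sum.cong) auto
  also have "\<dots> = (\<Sum>a\<in>C. x $ a)" by (simp add: sum.If_cases)
  finally show ?thesis .
qed

definition MTZ_constraints ::
    "'n::finite \<Rightarrow> real ^ ('n \<times> 'n) \<Rightarrow> ((real ^ ('n \<times> 'n)) \<times> real) set" where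
  "MTZ_constraints r d = (\<lambda>a. (- axis a 1, 0)) ` all_arcs
     \<union> (\<lambda>C. (arc_indicator C, real (card C) - (\<Sum>a\<in>C. d $ a))) ` nonroot_cycles r"

lemma P_MTZ_constraints:
  "P_MTZ r d = {x \<in> assignment_space. \<forall>(g, b)\<in>MTZ_constraints r d. g \<bullet> x \<le> b}"
  by (auto simp: P_MTZ_eq P_AP_eq MTZ_constraints_def inner_arc_indicator inner_axis' ball_Un)

lemma convex_P_MTZ: "convex (P_MTZ r d)"
proof -
  have "P_MTZ r d = assignment_space \<inter> (\<Inter>(g, b)\<in>MTZ_constraints r d. {x. g \<bullet> x \<le> b})"
    by (auto simp: P_MTZ_constraints)
  then show ?thesis
    by (auto intro!: convex_Int convex_INT affine_imp_convex[OF affine_assignment_space]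
        convex_halfspace_le)
qed

section \<open>Assignments, tours and the uniform point\<close>

definition assignment_vec :: "('n \<Rightarrow> 'n) \<Rightarrow> real ^ ('n::finite \<times> 'n)" where
  "assignment_vec f = (\<chi> a. if snd a = f (fst a) then 1 else 0)"

lemma assignment_vec_in_P_AP:
  assumes "bij f" and nofix: "\<And>i. f i \<noteq> i"
  shows "assignment_vec f \<in> P_AP"
proof -
  have "(\<Sum>j\<in>UNIV - {i}. assignment_vec f $ (i, j)) = 1" for i
    using nofix[of i] by (simp add: assignment_vec_def sum.delta)
  moreover have "(\<Sum>j\<in>UNIV - {i}. assignment_vec f $ (j, i)) = 1" for i
  proof -
    have eq: "i = f j \<longleftrightarrow> j = inv f i" for j
      using \<open>bij f\<close> by (metis bij_inv_eq_iff)
    moreover have "inv f i \<noteq> i" using eq nofix by metis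
    ultimately show ?thesis by (simp add: assignment_vec_def sum.delta)
  qed
  moreover have "assignment_vec f \<in> coord_space all_arcs"
    using nofix by (auto simp: coord_space_def all_arcs_def assignment_vec_def) metis
  ultimately show ?thesis
    by (auto simp: P_AP_eq assignment_space_def assignment_vec_def)
qed

text \<open>
  An assignment that leaves the cycle at some node misses at least one of its arcs. Since \<open>d\<close> has
  weight at most 1 on every cycle, losing one arc is enough to satisfy the cycle inequality.
\<close>

lemma sum_assignment_vec_cycle_le:
  assumes "distinct xs" "i \<in> set xs" "cycle_of_list xs i \<noteq> f i"
  shows "(\<Sum>a\<in>cycle_arcs xs. assignment_vec f $ a) \<le> real (card (cycle_arcs xs)) - 1"
proof -
  have "(\<Sum>a\<in>cycle_arcs xs. assignment_vec f $ a)
      = (\<Sum>j\<in>set xs - {i}. assignment_vec f $ (j, cycle_of_list xs j))"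
    unfolding sum_cycle_arcs using assms
    by (subst sum.remove[of _ i]) (auto simp: assignment_vec_def)
  also have "\<dots> \<le> (\<Sum>j\<in>set xs - {i}. 1)"
    by (intro sum_mono) (auto simp: assignment_vec_def)
  also have "\<dots> = real (card (set xs - {i}))" by simp
  also have "\<dots> = real (card (cycle_arcs xs)) - 1"
    using assms length_pos_if_in_set[of i xs]
    by (simp add: card_cycle_arcs distinct_card card_Diff_singleton of_nat_diff Suc_le_eq)
  finally show ?thesis .
qed

lemma D_bar_cycle_le: "d \<in> D_bar r \<Longrightarrow> C \<in> nonroot_cycles r \<Longrightarrow> (\<Sum>a\<in>C. d $ a) \<le> 1"
  by (simp add: D_bar_def)

text \<open>
  A cycle all of whose arcs belonged to the tour would have a node set closed under the successor
  map of the tour, so it would visit every node, whereas nonroot cycles avoid \<open>r\<close>.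
\<close>

lemma tour_in_P_MTZ:
  fixes r :: "'n::finite"
  assumes d: "d \<in> D_bar r" and xs: "distinct xs" "set xs = UNIV" "2 \<le> length xs"
  shows "assignment_vec (cycle_of_list xs) \<in> P_MTZ r d"
proof -
  let ?f = "cycle_of_list xs"
  have "assignment_vec ?f \<in> P_AP"
    using cycle_of_list_no_fixpoint[OF xs(1,3)]
    by (intro assignment_vec_in_P_AP) (auto simp: xs(2) permutation_of_cycle permutation_bijective)
  moreover have "(\<Sum>a\<in>C. assignment_vec ?f $ a) \<le> real (card C) - (\<Sum>a\<in>C. d $ a)"
    if C: "C \<in> nonroot_cycles r" for C
  proof -
    obtain ys where ys: "C = cycle_arcs ys" "distinct ys" "2 \<le> length ys" "r \<notin> set ys"
      using C by (auto simp: nonroot_cycles_eq)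
    have "\<exists>i\<in>set ys. cycle_of_list ys i \<noteq> ?f i"
    proof (rule ccontr)
      assume agree: "\<not> ?thesis"
      obtain i where "i \<in> set ys" using ys(3) by (cases ys) auto
      then have "set xs \<subseteq> set ys"
        using xs agree cycle_of_list_in_set[of _ ys]
        by (intro set_subset_of_cycle_closed[of xs i]) auto
      then show False using xs(2) ys(4) by auto
    qed
    then show ?thesis
      using sum_assignment_vec_cycle_le[OF ys(2)] D_bar_cycle_le[OF d C] unfolding ys(1)
      by fastforce
  qed
  ultimately show ?thesis by (simp add: P_MTZ_eq)
qed

lemma ex_tour_extending:
  fixes ps :: "'n::finite list"
  assumes "distinct ps"
  obtains zs where "distinct (ps @ zs)" "set (ps @ zs) = UNIV"
proof -
  obtain zs where "set zs = UNIV - set ps" "distinct zs"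
    using finite_distinct_list[of "UNIV - set ps"] by auto
  then show ?thesis using assms by (intro that[of zs]) auto
qed

text \<open>
  The barycentre of the assignment polytope. With at least 4 nodes and \<open>d \<in> D_bar r\<close> it satisfies
  the nonnegativity constraints and the cycle inequalities strictly, so \<open>P_MTZ r d\<close> is full-dimensional in the space of the assignment equations.
\<close>

definition uniform_vec :: "real ^ ('n::finite \<times> 'n)" where
  "uniform_vec = (\<chi> a. if a \<in> all_arcs then 1 / (real CARD('n) - 1) else 0)"

lemma uniform_vec_in_assignment_space:
  assumes "CARD('n::finite) \<ge> 2"
  shows "(uniform_vec :: real ^ ('n \<times> 'n)) \<in> assignment_space"
proof -
  have sum_one: "(\<Sum>j\<in>UNIV - {i}. (uniform_vec :: real ^ ('n \<times> 'n)) $ p j) = 1"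
    if "\<And>j. j \<noteq> i \<Longrightarrow> p j \<in> all_arcs" for i :: 'n and p
  proof -
    have "(\<Sum>j\<in>UNIV - {i}. (uniform_vec :: real ^ ('n \<times> 'n)) $ p j)
       = (\<Sum>j\<in>UNIV - {i}. 1 / (real CARD('n) - 1))"
      using that by (intro sum.cong) (auto simp: uniform_vec_def)
    also have "\<dots> = 1" using assms by (simp add: card_Diff_singleton of_nat_diff)
    finally show ?thesis .
  qed
  have "(\<Sum>j\<in>UNIV - {i}. (uniform_vec :: real ^ ('n \<times> 'n)) $ (i, j)) = 1"
    "(\<Sum>j\<in>UNIV - {i}. (uniform_vec :: real ^ ('n \<times> 'n)) $ (j, i)) = 1" for i
    by (rule sum_one; simp add: all_arcs_def)+
  then show ?thesis
    by (auto simp: assignment_space_def coord_space_def uniform_vec_def)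
qed

lemma uniform_vec_pos:
  assumes "CARD('n::finite) \<ge> 2" "a \<in> all_arcs"
  shows "0 < (uniform_vec :: real ^ ('n \<times> 'n)) $ a"
  using assms by (auto simp: uniform_vec_def)

text \<open>
  With \<open>m \<ge> 2\<close> arcs and at least 4 nodes, \<open>m / (CARD('n) - 1) \<le> m / 3 < m - 1\<close>, and the right-hand
  side of a cycle inequality is never below \<open>m - 1\<close>.
\<close>

lemma uniform_vec_cycle_less:
  fixes r :: "'n::finite"
  assumes n: "CARD('n) \<ge> 4" and d: "d \<in> D_bar r" and C: "C \<in> nonroot_cycles r"
  shows "(\<Sum>a\<in>C. uniform_vec $ a) < real (card C) - (\<Sum>a\<in>C. d $ a)"
proof -
  obtain xs where xs: "C = cycle_arcs xs" "distinct xs" "2 \<le> length xs"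
    using C by (auto simp: nonroot_cycles_eq)
  have "(\<Sum>a\<in>C. uniform_vec $ a) = (\<Sum>a\<in>C. 1 / (real CARD('n) - 1))"
    using cycle_arcs_subset_all_arcs[OF xs(2,3)] unfolding xs(1)
    by (intro sum.cong) (auto simp: uniform_vec_def)
  also have "\<dots> = real (card C) / (real CARD('n) - 1)" by simp
  also have "\<dots> \<le> real (card C) / 3"
    using n by (intro divide_left_mono) auto
  also have "\<dots> < real (card C) - 1"
    using xs by (simp add: card_cycle_arcs)
  also have "\<dots> \<le> real (card C) - (\<Sum>a\<in>C. d $ a)"
    using D_bar_cycle_le[OF d C] by simp
  finally show ?thesis .
qed

lemma uniform_vec_in_P_MTZ:
  fixes r :: "'n::finite"
  assumes n: "CARD('n) \<ge> 4" and d: "d \<in> D_bar r"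
  shows "uniform_vec \<in> P_MTZ r d"
  using uniform_vec_cycle_less[OF n d] n uniform_vec_in_assignment_space[where 'n = 'n]
    uniform_vec_pos[where 'n = 'n]
  by (auto simp: P_MTZ_eq P_AP_eq less_imp_le)

section \<open>The cycles that define facets\<close>

text \<open>
  The point that violates the inequality of \<open>C\<close> and no other constraint is the assignment made of
  \<open>C\<close> and one more cycle through all the remaining nodes, of which there are at least two. That
  second cycle contains \<open>r\<close>, so \<open>C\<close> is the only nonroot cycle that this assignment contains. The
  violation is \<open>\<Sum>a\<in>C. d $ a\<close>, and this is where positivity enters.
\<close>

lemma cycle_facet:
  fixes r :: "'n::finite"
  assumes n: "CARD('n) \<ge> 4" and d: "d \<in> D_bar r" and C: "C \<in> nonroot_cycles r"
    and pos: "0 < (\<Sum>a\<in>C. d $ a)" and small: "card C \<le> CARD('n) - 2"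
  shows "{x \<in> P_MTZ r d. (\<Sum>a\<in>C. x $ a) = real (card C) - (\<Sum>a\<in>C. d $ a)} facet_of P_MTZ r d"
proof -
  obtain xs where xs: "C = cycle_arcs xs" "distinct xs" "2 \<le> length xs" "r \<notin> set xs"
    using C by (auto simp: nonroot_cycles_eq)
  obtain ys where ys: "set ys = UNIV - set xs" "distinct ys"
    using finite_distinct_list[of "UNIV - set xs"] by auto
  have "length ys = CARD('n) - card C"
    using ys xs card_Diff_subset[of "set xs" UNIV]
    by (metis card_cycle_arcs distinct_card finite_set subset_UNIV)
  then have ys2: "2 \<le> length ys" using small n by linarith
  define f where "f = cycle_of_list xs \<circ> cycle_of_list ys"
  have f1: "f i = cycle_of_list xs i" if "i \<in> set xs" for i
    using that ys(1) id_outside_supp[of i ys] by (simp add: f_def)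
  have f2: "f i = cycle_of_list ys i" if "i \<in> set ys" for i
    using cycle_of_list_in_set[OF that] ys(1) id_outside_supp[of "cycle_of_list ys i" xs]
    by (simp add: f_def)
  have inset: "i \<in> set xs \<or> i \<in> set ys" for i using ys(1) by auto
  have AP: "assignment_vec f \<in> P_AP"
  proof (rule assignment_vec_in_P_AP)
    show "bij f" unfolding f_def
      by (intro bij_comp permutation_bijective permutation_of_cycle)
    show "f i \<noteq> i" for i
      using inset[of i] f1 f2 cycle_of_list_no_fixpoint[OF xs(2,3)]
        cycle_of_list_no_fixpoint[OF ys(2) ys2] by auto
  qed
  have full: "(\<Sum>a\<in>C. assignment_vec f $ a) = real (card C)"
    using xs(2) f1 by (simp add: xs(1) sum_cycle_arcs card_cycle_arcs assignment_vec_def distinct_card)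
  have other: "(\<Sum>a\<in>C'. assignment_vec f $ a) \<le> real (card C') - (\<Sum>a\<in>C'. d $ a)"
    if C': "C' \<in> nonroot_cycles r" "C' \<noteq> C" for C'
  proof -
    obtain zs where zs: "C' = cycle_arcs zs" "distinct zs" "2 \<le> length zs" "r \<notin> set zs"
      using C' by (auto simp: nonroot_cycles_eq)
    have "\<exists>i\<in>set zs. cycle_of_list zs i \<noteq> f i"
    proof (rule ccontr)
      assume "\<not> ?thesis"
      then have agree: "\<And>i. i \<in> set zs \<Longrightarrow> f i = cycle_of_list zs i" by auto
      have disj: "set zs \<inter> set ys = {}"
      proof (rule ccontr)
        assume "set zs \<inter> set ys \<noteq> {}"
        then obtain i where "i \<in> set zs" "i \<in> set ys" by auto
        then have "set ys \<subseteq> set zs"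
          using ys(2) by (intro set_subset_of_cycle_closed[of ys i])
            (auto simp flip: f2 simp: agree cycle_of_list_in_set)
        then show False using ys(1) xs(4) zs(4) by auto
      qed
      \<comment> \<open>A cycle within the nodes of \<open>C\<close> that follows the same successor map must be \<open>C\<close>.\<close>
      obtain i where i: "i \<in> set zs" using zs(3) by (cases zs) auto
      have sub: "set zs \<subseteq> set xs" using disj inset by blast
      have "set xs \<subseteq> set zs"
        using xs(2) i sub by (intro set_subset_of_cycle_closed[of xs i])
          (auto simp flip: f1 simp: agree cycle_of_list_in_set)
      then have "C' = C"
        using sub agree f1 unfolding zs(1) xs(1) cycle_arcs_def by (intro image_cong) auto
      then show False using C'(2) by simp
    qed
    then show ?thesis
      using sum_assignment_vec_cycle_le[OF zs(2)] D_bar_cycle_le[OF d C'(1)] unfolding zs(1)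
      by fastforce
  qed
  have "(P_MTZ r d \<inter> {x. arc_indicator C \<bullet> x = real (card C) - (\<Sum>a\<in>C. d $ a)}) facet_of P_MTZ r d"
  proof (rule facet_of_violated_inequality)
    show "finite (MTZ_constraints r d)" by (simp add: MTZ_constraints_def)
    show "affine (assignment_space :: (real ^ ('n \<times> 'n)) set)" by (rule affine_assignment_space)
    show "P_MTZ r d = {x \<in> assignment_space. \<forall>(g, b)\<in>MTZ_constraints r d. g \<bullet> x \<le> b}"
      by (rule P_MTZ_constraints)
    show "(uniform_vec :: real ^ ('n \<times> 'n)) \<in> assignment_space"
      using n by (intro uniform_vec_in_assignment_space) simp
    show "g \<bullet> uniform_vec < b" if "(g, b) \<in> MTZ_constraints r d" for g b
      using that uniform_vec_cycle_less[OF n d] uniform_vec_pos[where 'n = 'n] n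
      by (auto simp: MTZ_constraints_def inner_arc_indicator inner_axis')
    show "(arc_indicator C, real (card C) - (\<Sum>a\<in>C. d $ a)) \<in> MTZ_constraints r d"
      using C by (auto simp: MTZ_constraints_def)
    show "assignment_vec f \<in> assignment_space" using AP by (simp add: P_AP_eq)
    show "real (card C) - (\<Sum>a\<in>C. d $ a) < arc_indicator C \<bullet> assignment_vec f"
      using full pos by (simp add: inner_arc_indicator)
    show "g \<bullet> assignment_vec f \<le> b" if "(g, b) \<in> MTZ_constraints r d"
      "(g, b) \<noteq> (arc_indicator C, real (card C) - (\<Sum>a\<in>C. d $ a))" for g b
      using that(1)[unfolded MTZ_constraints_def]
    proof
      assume "(g, b) \<in> (\<lambda>a. (- axis a 1, 0)) ` all_arcs"
      then show ?thesis using AP by (auto simp: P_AP_eq inner_axis')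
    next
      assume "(g, b) \<in> (\<lambda>C. (arc_indicator C, real (card C) - (\<Sum>a\<in>C. d $ a))) ` nonroot_cycles r"
      then obtain C' where "C' \<in> nonroot_cycles r" "g = arc_indicator C'"
          "b = real (card C') - (\<Sum>a\<in>C'. d $ a)" by auto
      then show ?thesis using other[of C'] that(2) by (auto simp: inner_arc_indicator)
    qed
  qed
  moreover have "P_MTZ r d \<inter> {x. arc_indicator C \<bullet> x = real (card C) - (\<Sum>a\<in>C. d $ a)}
    = {x \<in> P_MTZ r d. (\<Sum>a\<in>C. x $ a) = real (card C) - (\<Sum>a\<in>C. d $ a)}"
    by (auto simp: inner_arc_indicator)
  ultimately show ?thesis by simp
qed

section \<open>The cycles that do not define facets\<close>

text \<open>
  The points with \<open>x $ a = 0\<close> form a proper face, as the uniform point is positive on \<open>a\<close>. A facet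
  contained in it would equal it by maximality, which one further point \<open>y\<close> of that face refutes.
\<close>

lemma not_facet_of_zero_arc:
  fixes r :: "'n::finite"
  assumes n: "CARD('n) \<ge> 4" and d: "d \<in> D_bar r" and a: "a \<in> all_arcs"
    and F: "F \<subseteq> P_MTZ r d" "\<And>x. x \<in> F \<Longrightarrow> x $ a = 0"
    and y: "y \<in> P_MTZ r d" "y $ a = 0" "y \<notin> F"
  shows "\<not> F facet_of P_MTZ r d"
proof
  assume facet: "F facet_of P_MTZ r d"
  let ?G = "P_MTZ r d \<inter> {x. axis a 1 \<bullet> x = 0}"
  have "?G face_of P_MTZ r d"
    using a by (intro face_of_Int_supporting_hyperplane_ge convex_P_MTZ)
      (auto simp: P_MTZ_eq P_AP_eq inner_axis')
  moreover have "?G \<noteq> P_MTZ r d"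
    using uniform_vec_in_P_MTZ[OF n d] uniform_vec_pos[OF _ a] n by (force simp: inner_axis')
  ultimately have "F = ?G"
    using F facet by (intro facet_maximal[OF convex_P_MTZ]) (auto simp: inner_axis')
  then show False using y by (simp add: inner_axis')
qed

lemma ex_in_Diff_of_card_less:
  assumes "finite B" "card B < card A"
  obtains x where "x \<in> A" "x \<notin> B"
  using assms by (metis card_mono not_less subsetI)

text \<open>
  If \<open>d\<close> has total weight 0 on \<open>C\<close>, equality forces \<open>x = 1\<close> on every arc of \<open>C\<close>. For an arc \<open>(i, j)\<close> of \<open>C\<close>
  this makes \<open>x\<close> vanish on every other arc that leaves \<open>i\<close>, say on \<open>(i, k)\<close>. A tour that leaves \<open>i\<close>
  towards a fourth node \<open>l\<close> also avoids \<open>(i, k)\<close>, yet it does not lie on the face.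
\<close>

lemma no_facet_if_sum_zero:
  fixes r :: "'n::finite"
  assumes n: "CARD('n) \<ge> 4" and d: "d \<in> D_bar r" and C: "C \<in> nonroot_cycles r"
    and zero: "(\<Sum>a\<in>C. d $ a) = 0"
  shows "\<not> {x \<in> P_MTZ r d. (\<Sum>a\<in>C. x $ a) = real (card C)} facet_of P_MTZ r d"
proof -
  obtain xs where xs: "C = cycle_arcs xs" "distinct xs" "2 \<le> length xs" "r \<notin> set xs"
    using C by (auto simp: nonroot_cycles_eq)
  obtain i where i: "i \<in> set xs" using xs(3) by (cases xs) auto
  define j where "j = cycle_of_list xs i"
  have ij: "i \<noteq> j" "(i, j) \<in> C"
    using cycle_of_list_no_fixpoint[OF xs(2,3) i] i by (auto simp: j_def xs(1) cycle_arcs_def)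
  have "card {i, j} < CARD('n)"
    using n by (simp add: card_insert_if)
  then obtain k where k: "k \<notin> {i, j}"
    using ex_in_Diff_of_card_less[of "{i, j}" UNIV] by blast
  have "card {i, j, k} < CARD('n)"
    using n by (simp add: card_insert_if)
  then obtain l where l: "l \<notin> {i, j, k}"
    using ex_in_Diff_of_card_less[of "{i, j, k}" UNIV] by blast
  note kl = k l
  have "distinct [i, l]" using kl by auto
  then obtain zs where zs: "distinct ([i, l] @ zs)" "set ([i, l] @ zs) = UNIV"
    by (rule ex_tour_extending)
  let ?g = "cycle_of_list ([i, l] @ zs)"
  have gi: "?g i = l"
    using cycle_of_list_nth[OF zs(1), of 0] by simp
  have C_le: "(\<Sum>a\<in>C. assignment_vec ?g $ a) \<le> real (card C) - 1"
    using sum_assignment_vec_cycle_le[OF xs(2) i, of ?g] gi kl unfolding xs(1) j_def by auto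
  show ?thesis
  proof (rule not_facet_of_zero_arc[OF n d, of "(i, k)" _ "assignment_vec ?g"])
    show "(i, k) \<in> all_arcs" using kl by (auto simp: all_arcs_def)
    show "assignment_vec ?g \<in> P_MTZ r d" using zs by (intro tour_in_P_MTZ[OF d]) auto
    show "assignment_vec ?g $ (i, k) = 0" using gi kl by (auto simp: assignment_vec_def)
    show "assignment_vec ?g \<notin> {x \<in> P_MTZ r d. (\<Sum>a\<in>C. x $ a) = real (card C)}"
      using C_le by auto
    fix x assume "x \<in> {x \<in> P_MTZ r d. (\<Sum>a\<in>C. x $ a) = real (card C)}"
    then have x: "x \<in> P_AP" "(\<Sum>a\<in>C. x $ a) = real (card C)" by (auto simp: P_MTZ_eq)
    have le1: "x $ a \<le> 1" if "a \<in> C" for a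
      using that x(1) cycle_arcs_subset_all_arcs[OF xs(2,3)] by (auto simp: P_AP_def xs(1))
    have "x $ (i, j) = 1"
    proof (rule ccontr)
      assume "x $ (i, j) \<noteq> 1"
      then have "(\<Sum>a\<in>C. x $ a) < (\<Sum>a\<in>C. 1)"
        using ij(2) le1 by (intro sum_strict_mono_ex1) (auto simp: xs(1) less_le)
      then show False using x(2) by simp
    qed
    moreover have "x $ (i, j) + x $ (i, k) \<le> (\<Sum>m\<in>UNIV - {i}. x $ (i, m))"
    proof -
      have "(\<Sum>m\<in>{j, k}. x $ (i, m)) \<le> (\<Sum>m\<in>UNIV - {i}. x $ (i, m))"
        using ij kl x(1) by (intro sum_mono2) (auto simp: P_AP_def all_arcs_def)
      then show ?thesis using kl by auto
    qed
    moreover have "(\<Sum>m\<in>UNIV - {i}. x $ (i, m)) = 1" "0 \<le> x $ (i, k)"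
      using x(1) kl by (auto simp: P_AP_def all_arcs_def)
    ultimately show "x $ (i, k) = 0" by linarith
  qed auto
qed

text \<open>
  All assignments have total weight \<open>CARD('n)\<close>, of which the arcs into \<open>r\<close> and out of \<open>r\<close> carry 1
  each.
\<close>

lemma sum_nonroot_arcs:
  fixes r :: "'n::finite"
  assumes x: "x \<in> assignment_space"
  shows "(\<Sum>a\<in>nonroot_arcs r. x $ a) = real CARD('n) - 2"
proof -
  have "nonroot_arcs r = Sigma (UNIV - {r}) (\<lambda>i. UNIV - {i} - {r})"
    by (auto simp: nonroot_arcs_def nonroot_nodes_def)
  then have "(\<Sum>a\<in>nonroot_arcs r. x $ a) = (\<Sum>i\<in>UNIV - {r}. \<Sum>j\<in>UNIV - {i} - {r}. x $ (i, j))"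
    by (simp add: sum.Sigma)
  also have "\<dots> = (\<Sum>i\<in>UNIV - {r}. 1 - x $ (i, r))"
    using x by (intro sum.cong) (auto simp: sum_diff1 assignment_space_def)
  also have "\<dots> = real (card (UNIV - {r})) - 1"
    using x by (simp add: sum_subtractf assignment_space_def)
  also have "\<dots> = real CARD('n) - 2"
    by (simp add: card_Diff_singleton of_nat_diff Suc_le_eq)
  finally show ?thesis .
qed

text \<open>
  If \<open>C\<close> visits all nodes but \<open>r\<close>, the right-hand side is at least \<open>CARD('n) - 2\<close>, which is already
  the total weight of all nonroot arcs. So equality forces \<open>x\<close> to vanish on every nonroot arc outside
  \<open>C\<close>. Pick a node \<open>j\<close>, an arc \<open>(j, k)\<close> other than the one by which \<open>C\<close> leaves \<open>j\<close>, and an arc \<open>(l, j)\<close>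
  other than the one by which \<open>C\<close> enters \<open>j\<close>. A tour \<open>l \<rightarrow> j \<rightarrow> r \<rightarrow> \<dots>\<close> vanishes on the
  first of these arcs but not on the second.
\<close>

lemma no_facet_if_spanning:
  fixes r :: "'n::finite"
  assumes n: "CARD('n) \<ge> 4" and d: "d \<in> D_bar r" and C: "C \<in> nonroot_cycles r"
    and large: "card C > CARD('n) - 2"
  shows "\<not> {x \<in> P_MTZ r d. (\<Sum>a\<in>C. x $ a) = real (card C) - (\<Sum>a\<in>C. d $ a)} facet_of P_MTZ r d"
    (is "\<not> ?F facet_of _")
proof -
  obtain xs where xs: "C = cycle_arcs xs" "distinct xs" "2 \<le> length xs" "r \<notin> set xs"
    using C by (auto simp: nonroot_cycles_eq)
  have "card (set xs) \<ge> card (UNIV - {r})"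
    using large xs by (simp add: card_cycle_arcs distinct_card card_Diff_singleton)
  then have set_xs: "set xs = UNIV - {r}"
    using xs(4) by (intro card_seteq) auto
  have card_C: "card C = CARD('n) - 1"
    using xs(2) distinct_card[of xs] by (simp add: xs(1) card_cycle_arcs set_xs card_Diff_singleton)
  have sub: "C \<subseteq> nonroot_arcs r"
    unfolding xs(1) by (rule cycle_arcs_subset_nonroot_arcs[OF xs(2-4)])
  let ?f = "cycle_of_list xs"
  have zero: "x $ a = 0" if x: "x \<in> ?F" and a: "a \<in> nonroot_arcs r - C" for x a
  proof -
    have AP: "x \<in> assignment_space" "\<And>a. a \<in> nonroot_arcs r \<Longrightarrow> 0 \<le> x $ a"
      using x by (auto simp: P_MTZ_eq P_AP_eq nonroot_arcs_def all_arcs_def)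
    have "x $ a \<le> (\<Sum>a\<in>nonroot_arcs r - C. x $ a)"
      using a AP(2) by (intro member_le_sum) auto
    also have "\<dots> = (\<Sum>a\<in>nonroot_arcs r. x $ a) - (\<Sum>a\<in>C. x $ a)"
      using sub by (simp add: sum_diff)
    also have "\<dots> \<le> 0"
      using sum_nonroot_arcs[OF AP(1), of r] x D_bar_cycle_le[OF d C] n card_C by simp
    finally show ?thesis using AP(2)[of a] a by auto
  qed
  obtain j where j: "j \<in> set xs" using xs(3) by (cases xs) auto
  have avoid: "card {j, i} < card (set xs)" for i
    using n by (cases "j = i") (auto simp: set_xs card_Diff_singleton)
  obtain k where k: "k \<in> set xs" "k \<noteq> j" "k \<noteq> ?f j"
    using ex_in_Diff_of_card_less[OF _ avoid[of "?f j"]] by auto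
  obtain l where l: "l \<in> set xs" "l \<noteq> j" "l \<noteq> inv ?f j"
    using ex_in_Diff_of_card_less[OF _ avoid[of "inv ?f j"]] by auto
  have "?f l \<noteq> j"
    using l(3) permutes_inv_eq[OF cycle_permutes[of xs]] by metis
  then have lj: "(l, j) \<in> nonroot_arcs r - C"
    using l j xs(4) by (auto simp: xs(1) cycle_arcs_def nonroot_arcs_def nonroot_nodes_def)
  have jk: "(j, k) \<in> nonroot_arcs r - C"
    using k j xs(4) by (auto simp: xs(1) cycle_arcs_def nonroot_arcs_def nonroot_nodes_def)
  have "distinct [l, j, r]" using l j xs(4) by auto
  then obtain zs where zs: "distinct ([l, j, r] @ zs)" "set ([l, j, r] @ zs) = UNIV"
    by (rule ex_tour_extending)
  let ?g = "cycle_of_list ([l, j, r] @ zs)"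
  have gl: "?g l = j" and gj: "?g j = r"
    using cycle_of_list_nth[OF zs(1), of 0] cycle_of_list_nth[OF zs(1), of 1] by auto
  show ?thesis
  proof (rule not_facet_of_zero_arc[OF n d, of "(j, k)" _ "assignment_vec ?g"])
    show "(j, k) \<in> all_arcs" using k by (auto simp: all_arcs_def)
    show "assignment_vec ?g \<in> P_MTZ r d" using zs by (intro tour_in_P_MTZ[OF d]) auto
    show "assignment_vec ?g $ (j, k) = 0"
      using gj k xs(4) by (auto simp: assignment_vec_def)
    show "assignment_vec ?g \<notin> ?F"
      using zero[OF _ lj, of "assignment_vec ?g"] gl by (auto simp: assignment_vec_def)
    show "x $ (j, k) = 0" if "x \<in> ?F" for x using zero[OF that jk] .
  qed auto
qed

section \<open>The characterisation\<close>

theorem proposition13: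
  fixes r :: "'n::finite" and d :: "real ^ ('n \<times> 'n)" and C :: "('n \<times> 'n) set"
  assumes "CARD('n) \<ge> 4"
    and "d \<in> D_bar r"
    and "C \<in> nonroot_cycles r"
  shows "defines_facet (\<lambda>x. \<Sum>a\<in>C. x $ a) (real (card C) - (\<Sum>a\<in>C. d $ a)) (P_MTZ r d)
    \<longleftrightarrow> (\<Sum>a\<in>C. d $ a) > 0 \<and> card C \<le> CARD('n) - 2"
proof -
  have valid: "\<forall>x\<in>P_MTZ r d. (\<Sum>a\<in>C. x $ a) \<le> real (card C) - (\<Sum>a\<in>C. d $ a)"
    using assms(3) by (auto simp: P_MTZ_eq)
  have "0 \<le> d $ a" for a
    using assms(2) by (cases a; cases "a \<in> nonroot_arcs r") (auto simp: D_bar_def coord_space_def)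
  then have nonneg: "0 \<le> (\<Sum>a\<in>C. d $ a)" by (intro sum_nonneg)
  show ?thesis
  proof
    assume "defines_facet (\<lambda>x. \<Sum>a\<in>C. x $ a) (real (card C) - (\<Sum>a\<in>C. d $ a)) (P_MTZ r d)"
    then have facet: "{x \<in> P_MTZ r d. (\<Sum>a\<in>C. x $ a) = real (card C) - (\<Sum>a\<in>C. d $ a)} facet_of P_MTZ r d"
      by (simp add: defines_facet_def)
    then have "(\<Sum>a\<in>C. d $ a) \<noteq> 0"
      using no_facet_if_sum_zero[OF assms] by force
    moreover have "card C \<le> CARD('n) - 2"
      using no_facet_if_spanning[OF assms] facet by (meson not_le)
    ultimately show "(\<Sum>a\<in>C. d $ a) > 0 \<and> card C \<le> CARD('n) - 2"
      using nonneg by simp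
  next
    assume "(\<Sum>a\<in>C. d $ a) > 0 \<and> card C \<le> CARD('n) - 2"
    then show "defines_facet (\<lambda>x. \<Sum>a\<in>C. x $ a) (real (card C) - (\<Sum>a\<in>C. d $ a)) (P_MTZ r d)"
      using valid cycle_facet[OF assms] by (simp add: defines_facet_def)
  qed
qed

end
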